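(* Let $\{\Omega_k\}_{k=1}^\infty$ be a sequence of convex polygonal domains in $\mathbb{R}^2$, where $\Omega_k$ has $N_k$ sides and interior angles $\theta_{k,1},\dots,\theta_{k,N_k}$. Let $\Omega\subset\mathbb{R}^2$ be a non-empty bounded convex domain with smooth boundary, and assume that $\overline{\Omega_k}\to\overline{\Omega}$ in Hausdorff distance as $k\to\infty$. Then $$\lim_{k\to\infty}\left(-\frac{1}{8\pi}\sum_{j=1}^{N_k}\sin\left(\frac{\pi^2}{\theta_{k,j}}\right)\int_{-\infty}^{\infty}\frac{1}{(1+\cosh(s))\left(\cosh(\pi s/\theta_{k,j})-\cos(\pi^2/\theta_{k,j})\right)}\,ds\right)=\frac16,$$ where the expression in parentheses is considered for $k$ sufficiently large.
   Context: A domain in $\mathbb{R}^2$ is a connected open subset of $\mathbb{R}^2$; its closure is always assumed compact. An isometry of $\mathbb{R}^2$ is a composition of rotations, translations and reflections. For $\Theta,\Omega\subset\mathbb{R}^2$ put $$d_H(\Theta,\Omega)=\max\left\{\sup_{x\in\Theta}\inf_{y\in\Omega}\|x-y\|,\ \sup_{x\in\Omega}\inf_{y\in\Theta}\|x-y\|\right\},\qquad D(\Theta,\Omega)=\inf_{T,S\text{ isometries}}d_H(T(\Theta),S(\Omega)).$$ Sets $\Omega_k$ converge in Hausdorff distance to $\Omega$, written $\Omega_k\to\Omega$, if $D(\Omega_k,\Omega)\to0$ as $k\to\infty$. *)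

theory Defs
  imports "HOL-Analysis.Analysis"
begin

definition planar_domain :: "(real^2) set \<Rightarrow> bool" where
  "planar_domain \<Omega> \<longleftrightarrow> open \<Omega> \<and> connected \<Omega> \<and> compact (closure \<Omega>)"

text \<open>In the plane, the orthogonal matrices of determinant \<open>-1\<close> are exactly the
  reflections across lines through the origin; rotations about other points and reflections
  across other lines arise by conjugating with translations.\<close>

inductive planar_isometry :: "(real^2 \<Rightarrow> real^2) \<Rightarrow> bool" where
  translation: "planar_isometry (\<lambda>x. a + x)"
| rotation: "rotation_matrix A \<Longrightarrow> planar_isometry (\<lambda>x. A *v x)"
| reflection: "rotoinversion_matrix A \<Longrightarrow> planar_isometry (\<lambda>x. A *v x)"
| composition: "planar_isometry S \<Longrightarrow> planar_isometry T \<Longrightarrow> planar_isometry (S \<circ> T)"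

text \<open>The suprema and infima below are real-valued, hence meaningful for non-empty bounded
  sets only.\<close>

definition hausdorff_dist :: "(real^2) set \<Rightarrow> (real^2) set \<Rightarrow> real" where
  "hausdorff_dist \<Theta> \<Omega> =
     max (SUP x\<in>\<Theta>. INF y\<in>\<Omega>. norm (x - y)) (SUP x\<in>\<Omega>. INF y\<in>\<Theta>. norm (x - y))"

definition hausdorff_dist_mod_isometry :: "(real^2) set \<Rightarrow> (real^2) set \<Rightarrow> real" where
  "hausdorff_dist_mod_isometry \<Theta> \<Omega> =
     (INF (T, S) \<in> {(T, S). planar_isometry T \<and> planar_isometry S}.
        hausdorff_dist (T ` \<Theta>) (S ` \<Omega>))"

definition hausdorff_converges :: "(nat \<Rightarrow> (real^2) set) \<Rightarrow> (real^2) set \<Rightarrow> bool" where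
  "hausdorff_converges \<Omega>s \<Omega> \<longleftrightarrow>
     (\<lambda>k. hausdorff_dist_mod_isometry (\<Omega>s k) \<Omega>) \<longlonglongrightarrow> 0"

definition convex_polygonal_domain :: "(real^2) set \<Rightarrow> bool" where
  "convex_polygonal_domain \<Omega> \<longleftrightarrow>
     planar_domain \<Omega> \<and> \<Omega> \<noteq> {} \<and> convex \<Omega> \<and> polytope (closure \<Omega>)"

definition angle_at :: "real^2 \<Rightarrow> real^2 \<Rightarrow> real^2 \<Rightarrow> real" where
  "angle_at a v b = arccos (((a - v) \<bullet> (b - v)) / (norm (a - v) * norm (b - v)))"

text \<open>By convexity the interior angle at a vertex is less than \<open>pi\<close>, so it is the unsigned
  angle between the two sides meeting there.\<close>

definition has_interior_angle :: "(real^2) set \<Rightarrow> real^2 \<Rightarrow> real \<Rightarrow> bool" where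
  "has_interior_angle \<Omega> v \<alpha> \<longleftrightarrow>
     (\<exists>a b. a \<noteq> b \<and> closed_segment v a edge_of closure \<Omega> \<and>
        closed_segment v b edge_of closure \<Omega> \<and> \<alpha> = angle_at a v b)"

text \<open>The angles \<open>\<theta> 1, \<dots>, \<theta> n\<close> are listed with one entry per vertex,
  in an arbitrary order.\<close>

definition has_sides_and_interior_angles :: "(real^2) set \<Rightarrow> nat \<Rightarrow> (nat \<Rightarrow> real) \<Rightarrow> bool" where
  "has_sides_and_interior_angles \<Omega> n \<theta> \<longleftrightarrow>
     card {e. e edge_of closure \<Omega>} = n \<and>
     (\<exists>v. bij_betw v {1..n} {x. x extreme_point_of closure \<Omega>} \<and>
          (\<forall>j\<in>{1..n}. has_interior_angle \<Omega> (v j) (\<theta> j)))"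

definition smooth_function :: "(real \<Rightarrow> real) \<Rightarrow> bool" where
  "smooth_function f \<longleftrightarrow> (\<forall>n x. (deriv ^^ n) f differentiable at x)"

text \<open>Near each boundary point, \<open>\<Omega>\<close> is, in suitable Cartesian coordinates, the
  region above the graph of a \<open>C\<close>-infinity function.\<close>

definition smooth_boundary :: "(real^2) set \<Rightarrow> bool" where
  "smooth_boundary \<Omega> \<longleftrightarrow>
     (\<forall>p\<in>frontier \<Omega>. \<exists>r>0. \<exists>T f. planar_isometry T \<and> smooth_function f \<and>
        \<Omega> \<inter> ball p r = {x \<in> ball p r. f (T x $ 1) < T x $ 2})"

definition corner_integrand :: "real \<Rightarrow> real \<Rightarrow> real" where
  "corner_integrand \<alpha> s = 1 / ((1 + cosh s) * (cosh (pi * s / \<alpha>) - cos (pi\<^sup>2 / \<alpha>)))"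

end

theory Submission
  imports Defs
begin

text \<open>
  A corner with interior angle \<open>\<alpha>\<close> close to \<open>pi\<close> contributes
  \<open>sin (pi\<^sup>2 / \<alpha>) * (LBINT s. corner_integrand \<alpha> s) = - (2 / 3 + o(1)) * (pi - \<alpha>)\<close>: the sine vanishes at
  \<open>\<alpha> = pi\<close> with slope 1, and by dominated convergence the integral tends to
  \<open>LBINT s. 1 / (1 + cosh s)\<^sup>2 = 2 / 3\<close> (lemma \<open>corner_term_estimate\<close>). The exterior angles of a convex
  polygon add up to \<open>2 * pi\<close> (lemma \<open>sum_exterior_angles\<close>). So if all interior angles tend to \<open>pi\<close>
  uniformly (lemma \<open>interior_angles_tend_to_pi\<close>), then the sum over the corners tends to
  \<open>- 4 * pi / 3\<close>, and the factor \<open>- 1 / (8 * pi)\<close> turns this into \<open>1 / 6\<close>. The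
  number of corners may grow without bound, but the error at a corner is a small multiple of its
  exterior angle, so the total error is at most a small multiple of \<open>2 * pi\<close>.

  Both geometric facts are read off from the cones of outward normals at the vertices, which
  avoids any cyclic ordering of the vertices. At a vertex with interior angle \<open>\<alpha>\<close> the directions in
  this cone form an arc of length \<open>pi - \<alpha>\<close>. The arcs of all vertices tile the circle, whence the angle
  sum. Were some angles bounded away from \<open>pi\<close> along a subsequence, there would be vertices with two
  unit normals enclosing an angle bounded away from 0; in the limit the smooth domain
  would have a boundary point with two distinct unit normals
  (lemmas \<open>approximate_normals\<close>, \<open>unique_unit_normal\<close>).
\<close>

section \<open>Exterior angles as arcs of normal directions\<close>

text \<open>A window of one period may start anywhere: the piece of the shifted window beyond \<open>p\<close>
  is the translate by one period of the piece that the shift removed at the start.\<close>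

lemma measure_period_window:
  fixes S :: "real set" and p c :: real
  assumes "closed S" and per: "\<And>t. t + p \<in> S \<longleftrightarrow> t \<in> S" and c: "0 \<le> c" "c \<le> p"
  shows "measure lebesgue (S \<inter> {c..c + p}) = measure lebesgue (S \<inter> {0..p})"
proof -
  have lm: "S \<inter> {a..b} \<in> lmeasurable" for a b
    using \<open>closed S\<close> by (intro lmeasurable_compact closed_Int_compact) auto
  have split: "measure lebesgue (S \<inter> {a..b}) + measure lebesgue (S \<inter> {b..d})
      = measure lebesgue (S \<inter> {a..d})" if "a \<le> b" "b \<le> d" for a b d
  proof -
    have "negligible ((S \<inter> {a..b}) \<inter> (S \<inter> {b..d}))"
      by (rule negligible_subset[of "{b}"]) auto
    then have "measure lebesgue ((S \<inter> {a..b}) \<union> (S \<inter> {b..d}))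
        = measure lebesgue (S \<inter> {a..b}) + measure lebesgue (S \<inter> {b..d})"
      using measure_Un3[OF lm lm, of a b b d] by (simp add: negligible_imp_measure0)
    moreover have "(S \<inter> {a..b}) \<union> (S \<inter> {b..d}) = S \<inter> {a..d}"
      using that by auto
    ultimately show ?thesis by simp
  qed
  have shift: "S \<inter> {p..c + p} = (+) p ` (S \<inter> {0..c})"
  proof (intro equalityI subsetI)
    fix t assume t: "t \<in> S \<inter> {p..c + p}"
    then have "t - p \<in> S \<inter> {0..c}" using per[of "t - p"] by auto
    then show "t \<in> (+) p ` (S \<inter> {0..c})" by (intro image_eqI[of _ _ "t - p"]) auto
  qed (use per in \<open>auto simp: add.commute\<close>)
  have "measure lebesgue (S \<inter> {c..c + p})
      = measure lebesgue (S \<inter> {c..p}) + measure lebesgue (S \<inter> {p..c + p})"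
    using split[of c p "c + p"] c by simp
  also have "\<dots> = measure lebesgue (S \<inter> {c..p}) + measure lebesgue (S \<inter> {0..c})"
    by (simp only: shift measure_translation)
  also have "\<dots> = measure lebesgue (S \<inter> {0..p})"
    using split[of 0 c p] c by simp
  finally show ?thesis .
qed

text \<open>Seen from the angle \<open>\<alpha>\<close>, the first half circle is \<open>[0, pi]\<close> and the second one
  \<open>[\<delta>, \<delta> + pi]\<close>, so up to isolated points they overlap in \<open>[\<delta>, pi]\<close>. Measuring periodic
  subsets of the line by their trace on one period stands in for arc length on the circle.\<close>

lemma measure_overlapping_half_circles:
  fixes \<alpha> \<delta> :: real
  assumes "0 \<le> \<alpha>" "\<alpha> \<le> 2 * pi" "0 \<le> \<delta>" "\<delta> \<le> pi"
  shows "measure lebesgue ({t. 0 \<le> sin (t - \<alpha>) \<and> 0 \<le> sin (t - \<alpha> - \<delta>)} \<inter> {0..2 * pi}) = pi - \<delta>"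
proof -
  let ?S = "{t. 0 \<le> sin (t - \<alpha>) \<and> 0 \<le> sin (t - \<alpha> - \<delta>)}"
  have "closed ?S"
    by (intro closed_Collect_conj closed_Collect_le continuous_intros)
  moreover have "t + 2 * pi \<in> ?S \<longleftrightarrow> t \<in> ?S" for t
    using sin_periodic[of "t - \<alpha>"] sin_periodic[of "t - \<alpha> - \<delta>"]
    by (simp add: algebra_simps)
  ultimately have "measure lebesgue (?S \<inter> {0..2 * pi}) = measure lebesgue (?S \<inter> {\<alpha>..\<alpha> + 2 * pi})"
    using assms by (intro measure_period_window[symmetric])
  also have "\<dots> = measure lebesgue {\<alpha> + \<delta>..\<alpha> + pi}"
  proof (rule measure_negligible_symdiff)
    show "{\<alpha> + \<delta>..\<alpha> + pi} \<in> lmeasurable" by simp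
    have out: "t = \<alpha> \<or> t = \<alpha> + 2 * pi \<or> t = \<alpha> + \<delta> - pi"
      if t: "t \<in> ?S" "\<alpha> \<le> t" "t \<le> \<alpha> + 2 * pi" "\<not> (\<alpha> + \<delta> \<le> t \<and> t \<le> \<alpha> + pi)" for t
    proof (rule ccontr)
      assume neq: "\<not> ?thesis"
      have "t \<le> \<alpha> + pi"
        using sin_lt_zero[of "t - \<alpha>"] t neq by force
      then show False
        using sin_gt_zero[of "\<alpha> + \<delta> - t"] sin_minus[of "\<alpha> + \<delta> - t"] t neq assms
          sin_lt_zero[of "t - \<alpha> - \<delta> + 2 * pi"] by (auto simp: algebra_simps)
    qed
    have inn: "t \<in> ?S \<inter> {\<alpha>..\<alpha> + 2 * pi}" if "\<alpha> + \<delta> \<le> t" "t \<le> \<alpha> + pi" for t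
      using that assms by (auto intro!: sin_ge_zero)
    have "sym_diff {\<alpha> + \<delta>..\<alpha> + pi} (?S \<inter> {\<alpha>..\<alpha> + 2 * pi}) \<subseteq> {\<alpha>, \<alpha> + 2 * pi, \<alpha> + \<delta> - pi}"
    proof
      fix t assume "t \<in> sym_diff {\<alpha> + \<delta>..\<alpha> + pi} (?S \<inter> {\<alpha>..\<alpha> + 2 * pi})"
      then show "t \<in> {\<alpha>, \<alpha> + 2 * pi, \<alpha> + \<delta> - pi}"
        using out[of t] inn[of t] by auto
    qed
    then show "negligible (sym_diff {\<alpha> + \<delta>..\<alpha> + pi} (?S \<inter> {\<alpha>..\<alpha> + 2 * pi}))"
      by (rule negligible_subset[rotated]) auto
  qed
  also have "\<dots> = pi - \<delta>" using assms by simp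
  finally show ?thesis .
qed

definition unit_dir :: "real \<Rightarrow> real^2" where
  "unit_dir t = vector [cos t, sin t]"

lemma inner_unit_dir: "unit_dir t \<bullet> x = cos t * x $ 1 + sin t * x $ 2"
  by (simp add: unit_dir_def inner_vec_def sum_2)

text \<open>The polar angle is shifted by a quarter turn, so that \<open>unit_dir t \<bullet> p = - norm p * sin (t - \<alpha>)\<close>
  and the condition \<open>unit_dir t \<bullet> p \<le> 0\<close> describes the half circle starting at \<open>\<alpha>\<close>.\<close>

lemma polar_form:
  fixes p :: "real^2"
  assumes "p \<noteq> 0"
  obtains \<alpha> where "0 \<le> \<alpha>" "\<alpha> < 2 * pi" "p $ 1 = norm p * sin \<alpha>" "p $ 2 = - norm p * cos \<alpha>"
proof -
  have n: "norm p ^ 2 = (p $ 1)\<^sup>2 + (p $ 2)\<^sup>2"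
    unfolding power2_norm_eq_inner by (simp add: inner_vec_def sum_2 power2_eq_square)
  have "(- p $ 2 / norm p)\<^sup>2 + (p $ 1 / norm p)\<^sup>2 = 1"
    unfolding power_divide add_divide_distrib[symmetric] using assms n
    by (simp add: add.commute del: sum_power2_eq_zero_iff) (metis norm_eq_zero power_not_zero n)
  then obtain t where "0 \<le> t" "t < 2 * pi" "- p $ 2 / norm p = cos t" "p $ 1 / norm p = sin t"
    using sincos_total_2pi by blast
  with assms show ?thesis
    by (intro that[of t]) (auto simp: field_simps)
qed

text \<open>The polar of a wedge with opening angle \<open>\<delta>\<close> is a wedge with opening angle \<open>pi - \<delta>\<close>: it is the
  intersection of two half planes whose boundary lines are turned against each other by \<open>\<delta>\<close>.\<close>

lemma measure_polar_wedge:
  fixes p q :: "real^2"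
  assumes "p \<noteq> 0" "q \<noteq> 0"
  shows "measure lebesgue ({t. unit_dir t \<bullet> p \<le> 0 \<and> unit_dir t \<bullet> q \<le> 0} \<inter> {0..2 * pi})
      = pi - arccos ((p \<bullet> q) / (norm p * norm q))"
proof -
  obtain \<alpha> where \<alpha>: "0 \<le> \<alpha>" "\<alpha> < 2 * pi" "p $ 1 = norm p * sin \<alpha>" "p $ 2 = - norm p * cos \<alpha>"
    using polar_form[OF assms(1)] .
  obtain \<beta> where \<beta>: "0 \<le> \<beta>" "\<beta> < 2 * pi" "q $ 1 = norm q * sin \<beta>" "q $ 2 = - norm q * cos \<beta>"
    using polar_form[OF assms(2)] .
  have "unit_dir t \<bullet> p = - norm p * sin (t - \<alpha>)" "unit_dir t \<bullet> q = - norm q * sin (t - \<beta>)" for t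
    unfolding inner_unit_dir \<alpha>(3,4) \<beta>(3,4) by (simp_all add: sin_diff algebra_simps)
  then have E: "{t. unit_dir t \<bullet> p \<le> 0 \<and> unit_dir t \<bullet> q \<le> 0}
      = {t. 0 \<le> sin (t - \<alpha>) \<and> 0 \<le> sin (t - \<beta>)}"
    using assms by (auto simp: mult_le_0_iff zero_le_mult_iff)
  define \<delta> where "\<delta> = arccos (cos (\<alpha> - \<beta>))"
  have \<delta>: "0 \<le> \<delta>" "\<delta> \<le> pi" "cos (\<alpha> - \<beta>) = cos \<delta>"
    by (simp_all add: \<delta>_def arccos_lbound arccos_ubound)
  have "p \<bullet> q = norm p * norm q * cos (\<alpha> - \<beta>)"
    unfolding inner_vec_def sum_2 using \<alpha>(3,4) \<beta>(3,4) by (simp add: cos_diff algebra_simps)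
  then have arc: "arccos ((p \<bullet> q) / (norm p * norm q)) = \<delta>"
    using assms by (simp add: \<delta>_def)
  \<comment> \<open>The angle between the vectors determines \<open>\<alpha> - \<beta>\<close> up to sign and full turns; the sign decides
    which of the two half circles comes first.\<close>
  obtain n :: int where "\<alpha> - \<beta> = \<delta> + 2 * n * pi \<or> \<alpha> - \<beta> = - \<delta> + 2 * n * pi"
    using \<delta>(3) unfolding cos_eq Ints_def by auto
  then show ?thesis
  proof
    assume *: "\<alpha> - \<beta> = \<delta> + 2 * n * pi"
    have "sin (t - \<alpha>) = sin (t - \<beta> - \<delta>)" for t
    proof -
      have "t - \<beta> - \<delta> = (t - \<alpha>) + 2 * pi * n" using * by (simp add: algebra_simps)
      then show ?thesis using sin_cos_eq_iff by metis
    qed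
    then show ?thesis
      unfolding E arc using measure_overlapping_half_circles[of \<beta> \<delta>] \<beta> \<delta> by (simp add: conj_commute)
  next
    assume *: "\<alpha> - \<beta> = - \<delta> + 2 * n * pi"
    have "sin (t - \<beta>) = sin (t - \<alpha> - \<delta>)" for t
    proof -
      have "t - \<beta> = (t - \<alpha> - \<delta>) + 2 * pi * n" using * by (simp add: algebra_simps)
      then show ?thesis using sin_cos_eq_iff by metis
    qed
    then show ?thesis
      unfolding E arc using measure_overlapping_half_circles[of \<alpha> \<delta>] \<alpha> \<delta> by simp
  qed
qed

definition normal_cone :: "'a::real_inner set \<Rightarrow> 'a \<Rightarrow> 'a set" where
  "normal_cone P v = {u. \<forall>x\<in>P. u \<bullet> (x - v) \<le> 0}"

lemma closed_normal_cone: "closed (normal_cone P v)"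
  unfolding normal_cone_def Collect_ball_eq by (intro closed_INT closed_Collect_le ballI continuous_intros)

text \<open>A linear functional on a polytope attains its maximum at a vertex.\<close>

lemma normal_cone_extreme_point:
  fixes P :: "'a::euclidean_space set"
  assumes "polytope P" "P \<noteq> {}"
  obtains v where "v extreme_point_of P" "u \<in> normal_cone P v"
proof -
  let ?V = "{x. x extreme_point_of P}"
  have hull: "P = convex hull ?V"
    using assms by (intro Krein_Milman_Minkowski polytope_imp_compact polytope_imp_convex)
  have fin: "finite ?V"
    using assms(1) by (metis (full_types) extreme_points_of_convex_hull finite_subset polytope_def)
  have ne: "?V \<noteq> {}" using assms(2) hull by auto
  have "Max ((\<bullet>) u ` ?V) \<in> (\<bullet>) u ` ?V" using fin ne by (intro Max_in) auto
  then obtain v where v: "v \<in> ?V" "u \<bullet> v = Max ((\<bullet>) u ` ?V)" by auto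
  have "?V \<subseteq> {x. u \<bullet> x \<le> u \<bullet> v}" using v fin by auto
  then have "P \<subseteq> {x. u \<bullet> x \<le> u \<bullet> v}"
    using hull by (metis convex_halfspace_le hull_minimal)
  then show ?thesis
    using v by (intro that[of v]) (auto simp: normal_cone_def inner_diff_right)
qed

lemma negligible_orthogonal_directions:
  assumes "w \<noteq> 0"
  shows "negligible {t. unit_dir t \<bullet> w = 0}"
proof -
  obtain \<gamma> where \<gamma>: "w $ 1 = norm w * sin \<gamma>" "w $ 2 = - norm w * cos \<gamma>"
    using polar_form[OF assms] by metis
  have "unit_dir t \<bullet> w = - norm w * sin (t - \<gamma>)" for t
    unfolding inner_unit_dir \<gamma> by (simp add: sin_diff algebra_simps)
  then have "{t. unit_dir t \<bullet> w = 0} \<subseteq> (\<lambda>n::int. n * pi + \<gamma>) ` UNIV"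
    using assms by (auto simp: sin_zero_iff_int2 image_iff algebra_simps)
  moreover have "countable ((\<lambda>n::int. n * pi + \<gamma>) ` UNIV)" by (intro countable_image) simp
  ultimately show ?thesis
    unfolding negligible_iff_null_sets
    by (intro null_sets_completionI countable_imp_null_set_lborel) (rule countable_subset)
qed

text \<open>The normal cones at the vertices tile the circle of directions. They cover it because each
  direction is maximised at some vertex, and a direction common to the cones at \<open>v\<close> and \<open>w\<close> is
  orthogonal to \<open>v - w\<close>, which leaves only countably many angles.\<close>

lemma sum_measure_normal_cones:
  fixes P :: "(real^2) set"
  assumes "polytope P" "P \<noteq> {}"
  shows "(\<Sum>v | v extreme_point_of P.
      measure lebesgue ({t. unit_dir t \<in> normal_cone P v} \<inter> {0..2 * pi})) = 2 * pi"
proof -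
  let ?V = "{x. x extreme_point_of P}"
  let ?E = "\<lambda>v. {t. unit_dir t \<in> normal_cone P v} \<inter> {0..2 * pi}"
  have fin: "finite ?V"
    using assms(1) by (metis (full_types) extreme_points_of_convex_hull finite_subset polytope_def)
  have cont: "continuous_on UNIV unit_dir"
    by (subst continuous_on_componentwise)
       (auto simp: unit_dir_def Basis_vec_def cart_eq_inner_axis[symmetric] forall_2 intro!: continuous_intros)
  have "closed {t. unit_dir t \<in> normal_cone P v}" for v
    using closed_vimage[OF closed_normal_cone cont] by (simp add: vimage_def)
  then have lm: "?E v \<in> lmeasurable" for v
    by (intro lmeasurable_compact closed_Int_compact) auto
  have "(\<Union>v\<in>?V. ?E v) = {0..2 * pi}"
  proof (intro equalityI subsetI)
    fix t :: real assume "t \<in> {0..2 * pi}"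
    moreover obtain v where "v extreme_point_of P" "unit_dir t \<in> normal_cone P v"
      using normal_cone_extreme_point[OF assms] .
    ultimately show "t \<in> (\<Union>v\<in>?V. ?E v)" by blast
  qed blast
  moreover have "measure lebesgue (\<Union>v\<in>?V. ?E v) = (\<Sum>v\<in>?V. measure lebesgue (?E v))"
  proof (rule measure_negligible_finite_Union_image[OF fin lm])
    have "negligible (?E v \<inter> ?E w)" if "v \<in> ?V" "w \<in> ?V" "v \<noteq> w" for v w
    proof (rule negligible_subset[OF negligible_orthogonal_directions])
      show "v - w \<noteq> 0" using that by simp
      have "v \<in> P" "w \<in> P" using that by (auto simp: extreme_point_of_def)
      then show "?E v \<inter> ?E w \<subseteq> {t. unit_dir t \<bullet> (v - w) = 0}"
        by (force simp: normal_cone_def inner_diff_right)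
    qed
    then show "pairwise (\<lambda>v w. negligible (?E v \<inter> ?E w)) ?V"
      by (simp add: pairwise_def)
  qed
  ultimately show ?thesis by simp
qed

text \<open>Each edge is cut out by a supporting line, and the two supporting functionals \<open>w1\<close>, \<open>w2\<close>
  are a (scaled) dual basis to the edge vectors \<open>p\<close>, \<open>q\<close>. Hence every point of the polygon is
  \<open>v\<close> plus a non-negative combination of \<open>p\<close> and \<open>q\<close>, so two edges at a vertex already determine
  the normal cone there.\<close>

lemma edges_at_vertex:
  fixes P :: "(real^2) set"
  assumes "polytope P" and e: "closed_segment v a edge_of P" "closed_segment v b edge_of P" and "a \<noteq> b"
  shows "normal_cone P v = {u. u \<bullet> (a - v) \<le> 0 \<and> u \<bullet> (b - v) \<le> 0}" (is ?cone)
    and "\<bar>(a - v) \<bullet> (b - v)\<bar> < norm (a - v) * norm (b - v)" (is ?indep)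
proof -
  define p q where "p = a - v" and "q = b - v"
  have face: "closed_segment v a face_of P" "closed_segment v b face_of P"
    and dim: "aff_dim (closed_segment v a) = 1" "aff_dim (closed_segment v b) = 1"
    using e by (auto simp: edge_of_def)
  have ne: "v \<noteq> a" "v \<noteq> b" using dim by auto
  have mem: "v \<in> P" "a \<in> P" "b \<in> P"
    using face_of_imp_subset[OF face(1)] face_of_imp_subset[OF face(2)] by auto
  have ext: "a extreme_point_of P" "b extreme_point_of P"
    using extreme_point_of_face[OF face(1), of a] extreme_point_of_face[OF face(2), of b]
    by (auto simp: extreme_point_of_segment)
  have "b \<notin> closed_segment v a" "a \<notin> closed_segment v b"
    using extreme_point_of_face[OF face(1), of b] extreme_point_of_face[OF face(2), of a] ext ne \<open>a \<noteq> b\<close>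
    by (auto simp: extreme_point_of_segment)
  moreover obtain w1 c1 where w1: "P \<subseteq> {x. w1 \<bullet> x \<le> c1}" "closed_segment v a = P \<inter> {x. w1 \<bullet> x = c1}"
    using face(1) exposed_face_of_polyhedron[OF polytope_imp_polyhedron[OF \<open>polytope P\<close>]]
    unfolding exposed_face_of_def by metis
  moreover obtain w2 c2 where w2: "P \<subseteq> {x. w2 \<bullet> x \<le> c2}" "closed_segment v b = P \<inter> {x. w2 \<bullet> x = c2}"
    using face(2) exposed_face_of_polyhedron[OF polytope_imp_polyhedron[OF \<open>polytope P\<close>]]
    unfolding exposed_face_of_def by metis
  ultimately have "w1 \<bullet> v = c1" "w1 \<bullet> a = c1" "w1 \<bullet> b \<noteq> c1" "w2 \<bullet> v = c2" "w2 \<bullet> b = c2" "w2 \<bullet> a \<noteq> c2"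
    using mem by (metis (mono_tags, lifting) Int_iff ends_in_segment mem_Collect_eq)+
  then have w: "w1 \<bullet> p = 0" "w1 \<bullet> q < 0" "w2 \<bullet> q = 0" "w2 \<bullet> p < 0"
    using w1(1) w2(1) mem by (auto simp: p_def q_def inner_diff_right dual_order.order_iff_strict)
  \<comment> \<open>The Cauchy--Binet identity turns the sign pattern in \<open>w\<close> into linear independence of
    both \<open>w1\<close>, \<open>w2\<close> and \<open>p\<close>, \<open>q\<close>.\<close>
  define det where "det = w1 $ 1 * w2 $ 2 - w1 $ 2 * w2 $ 1"
  define cross where "cross = q $ 1 * p $ 2 - q $ 2 * p $ 1"
  have "(w1 \<bullet> q) * (w2 \<bullet> p) - (w1 \<bullet> p) * (w2 \<bullet> q) = det * cross"
    by (simp add: inner_vec_def sum_2 det_def cross_def algebra_simps)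
  moreover have "(w1 \<bullet> q) * (w2 \<bullet> p) > 0" using w by (simp add: mult_neg_neg)
  ultimately have nz: "det \<noteq> 0" "cross \<noteq> 0" using w by auto
  have "(p \<bullet> q)\<^sup>2 = (norm p * norm q)\<^sup>2 - cross\<^sup>2"
    unfolding power_mult_distrib power2_norm_eq_inner
    by (simp add: inner_vec_def sum_2 cross_def power2_eq_square algebra_simps)
  also have "\<dots> < (norm p * norm q)\<^sup>2" using nz by simp
  finally have "\<bar>p \<bullet> q\<bar> < norm p * norm q"
    by (metis abs_le_square_iff abs_mult abs_norm_cancel not_le)
  then show ?indep by (simp add: p_def q_def)
  have comb: "\<exists>s\<ge>0. \<exists>t\<ge>0. x - v = s *\<^sub>R p + t *\<^sub>R q" if "x \<in> P" for x
  proof -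
    define s where "s = (w2 \<bullet> (x - v)) / (w2 \<bullet> p)"
    define t where "t = (w1 \<bullet> (x - v)) / (w1 \<bullet> q)"
    define z where "z = x - v - s *\<^sub>R p - t *\<^sub>R q"
    have "w1 \<bullet> z = 0" "w2 \<bullet> z = 0"
      using w by (simp_all add: z_def s_def t_def inner_diff_right)
    then have "w1 $ 1 * z $ 1 + w1 $ 2 * z $ 2 = 0" "w2 $ 1 * z $ 1 + w2 $ 2 * z $ 2 = 0"
      by (simp_all add: inner_vec_def sum_2)
    then have "det * z $ 1 = 0" "det * z $ 2 = 0"
      unfolding det_def by algebra+
    then have "z = 0" using nz by (simp add: vec_eq_iff forall_2)
    have "w1 \<bullet> (x - v) \<le> 0" "w2 \<bullet> (x - v) \<le> 0"
      using that w1(1) w2(1) \<open>w1 \<bullet> v = c1\<close> \<open>w2 \<bullet> v = c2\<close> by (auto simp: inner_diff_right)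
    then have "s \<ge> 0" "t \<ge> 0" using w by (simp_all add: s_def t_def divide_nonpos_neg)
    with \<open>z = 0\<close> show ?thesis unfolding z_def by (intro exI[of _ s] exI[of _ t]) (auto simp: algebra_simps)
  qed
  have "u \<in> normal_cone P v" if "u \<bullet> p \<le> 0" "u \<bullet> q \<le> 0" for u
  proof -
    have "u \<bullet> (x - v) \<le> 0" if "x \<in> P" for x
    proof -
      obtain s t where "s \<ge> 0" "t \<ge> 0" "x - v = s *\<^sub>R p + t *\<^sub>R q" using comb[OF \<open>x \<in> P\<close>] by blast
      then show ?thesis
        using \<open>u \<bullet> p \<le> 0\<close> \<open>u \<bullet> q \<le> 0\<close> by (simp add: inner_add_right add_nonpos_nonpos mult_nonneg_nonpos)
    qed
    then show ?thesis by (simp add: normal_cone_def)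
  qed
  moreover have "u \<bullet> p \<le> 0 \<and> u \<bullet> q \<le> 0" if "u \<in> normal_cone P v" for u
    using that mem by (auto simp: normal_cone_def p_def q_def)
  ultimately show ?cone by (auto simp: p_def q_def)
qed

text \<open>The witnesses are the unit normals of the two sides of the wedge: for unit vectors \<open>p\<close>, \<open>q\<close>
  with \<open>c = p \<bullet> q\<close>, subtracting from \<open>q\<close> its component along \<open>p\<close> leaves a vector of length
  \<open>sqrt (1 - c\<^sup>2)\<close>, and likewise with the roles exchanged.\<close>

lemma unit_normals_of_wedge:
  fixes p q :: "'a::real_inner"
  assumes "\<bar>p \<bullet> q\<bar> < norm p * norm q"
  obtains m n where "norm m = 1" "norm n = 1" "m \<bullet> p \<le> 0" "m \<bullet> q \<le> 0" "n \<bullet> p \<le> 0" "n \<bullet> q \<le> 0"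
    "m \<bullet> n = - ((p \<bullet> q) / (norm p * norm q))"
proof -
  have nz: "p \<noteq> 0" "q \<noteq> 0" using assms by auto
  define c where "c = (p \<bullet> q) / (norm p * norm q)"
  define p' q' where "p' = p /\<^sub>R norm p" and "q' = q /\<^sub>R norm q"
  have "\<bar>c\<bar> < 1" using assms nz by (simp add: c_def abs_mult field_simps)
  then have c: "c\<^sup>2 < 1" by (simp add: abs_square_less_1)
  have pq: "p' \<bullet> p' = 1" "q' \<bullet> q' = 1" "p' \<bullet> q' = c" "q' \<bullet> p' = c"
    using nz by (simp_all add: p'_def q'_def c_def dot_square_norm power2_eq_square field_simps inner_commute)
  define s where "s = sqrt (1 - c\<^sup>2)"
  have s: "s > 0" "s * s = 1 - c\<^sup>2" using c by (simp_all add: s_def)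
  define m n where "m = (c *\<^sub>R p' - q') /\<^sub>R s" and "n = (c *\<^sub>R q' - p') /\<^sub>R s"
  have "m \<bullet> m = (1 - c\<^sup>2) / (s * s)" "n \<bullet> n = (1 - c\<^sup>2) / (s * s)" "m \<bullet> n = - c * (1 - c\<^sup>2) / (s * s)"
    unfolding m_def n_def
    by (simp_all add: inner_diff_left inner_diff_right pq divide_inverse algebra_simps power2_eq_square)
  then have mn: "norm m = 1" "norm n = 1" "m \<bullet> n = - c"
    using s c by (simp_all add: norm_eq_1)
  have "m \<bullet> p' = 0" "n \<bullet> q' = 0" "m \<bullet> q' = - (1 - c\<^sup>2) / s" "n \<bullet> p' = - (1 - c\<^sup>2) / s"
    unfolding m_def n_def
    by (simp_all add: inner_diff_left inner_diff_right pq divide_inverse algebra_simps power2_eq_square)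
  then have "m \<bullet> p' \<le> 0" "n \<bullet> q' \<le> 0" "m \<bullet> q' \<le> 0" "n \<bullet> p' \<le> 0"
    using s c by (simp_all add: divide_nonpos_pos)
  then show ?thesis
    using that[OF mn(1,2)] mn(3) nz
    by (simp add: p'_def q'_def c_def mult_le_0_iff zero_le_mult_iff)
qed

text \<open>A vertex enters the argument through two traces of its interior angle \<open>\<alpha>\<close>: the arc of outward
  normal directions has length \<open>pi - \<alpha>\<close>, which gives the angle sum, and there are two
  unit normals enclosing the angle \<open>pi - \<alpha>\<close>, which is the form that survives in a Hausdorff limit.\<close>

lemma interior_angle_bounds:
  assumes "has_interior_angle \<Omega> v \<alpha>" "polytope (closure \<Omega>)"
  shows "0 \<le> \<alpha>" "\<alpha> \<le> pi"
    and "measure lebesgue ({t. unit_dir t \<in> normal_cone (closure \<Omega>) v} \<inter> {0..2 * pi}) = pi - \<alpha>"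
    and "\<exists>m\<in>normal_cone (closure \<Omega>) v. \<exists>n\<in>normal_cone (closure \<Omega>) v.
      norm m = 1 \<and> norm n = 1 \<and> m \<bullet> n = - cos \<alpha>"
proof -
  obtain a b where ab: "a \<noteq> b" "closed_segment v a edge_of closure \<Omega>" "closed_segment v b edge_of closure \<Omega>"
    and \<alpha>: "\<alpha> = arccos (((a - v) \<bullet> (b - v)) / (norm (a - v) * norm (b - v)))"
    using assms(1) by (auto simp: has_interior_angle_def angle_at_def)
  note E = edges_at_vertex[OF assms(2) ab(2,3,1)]
  have nz: "a - v \<noteq> 0" "b - v \<noteq> 0" using E(2) by auto
  define c where "c = ((a - v) \<bullet> (b - v)) / (norm (a - v) * norm (b - v))"
  have "\<bar>c\<bar> < 1" using E(2) nz by (simp add: c_def abs_mult field_simps)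
  then have c: "-1 \<le> c" "c \<le> 1" by auto
  have \<alpha>c: "\<alpha> = arccos c" by (simp add: \<alpha> c_def)
  show "0 \<le> \<alpha>" "\<alpha> \<le> pi" using c by (simp_all add: \<alpha>c arccos_lbound arccos_ubound)
  show "measure lebesgue ({t. unit_dir t \<in> normal_cone (closure \<Omega>) v} \<inter> {0..2 * pi}) = pi - \<alpha>"
    using measure_polar_wedge[OF nz] by (simp add: E(1) \<alpha>)
  obtain m n where "norm m = 1" "norm n = 1" "m \<bullet> (a - v) \<le> 0" "m \<bullet> (b - v) \<le> 0"
    "n \<bullet> (a - v) \<le> 0" "n \<bullet> (b - v) \<le> 0" "m \<bullet> n = - c"
    using unit_normals_of_wedge[OF E(2)] unfolding c_def by metis
  then show "\<exists>m\<in>normal_cone (closure \<Omega>) v. \<exists>n\<in>normal_cone (closure \<Omega>) v.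
      norm m = 1 \<and> norm n = 1 \<and> m \<bullet> n = - cos \<alpha>"
    unfolding E(1) using c by (intro bexI[of _ m] bexI[of _ n]) (auto simp: \<alpha>c)
qed

lemma sum_exterior_angles:
  assumes "convex_polygonal_domain \<Omega>" "has_sides_and_interior_angles \<Omega> N \<theta>"
  shows "(\<Sum>j=1..N. pi - \<theta> j) = 2 * pi"
proof -
  have P: "polytope (closure \<Omega>)" "closure \<Omega> \<noteq> {}"
    using assms(1) by (auto simp: convex_polygonal_domain_def)
  obtain v where v: "bij_betw v {1..N} {x. x extreme_point_of closure \<Omega>}"
    "\<And>j. j \<in> {1..N} \<Longrightarrow> has_interior_angle \<Omega> (v j) (\<theta> j)"
    using assms(2) by (auto simp: has_sides_and_interior_angles_def)
  have "(\<Sum>j=1..N. pi - \<theta> j) = (\<Sum>j=1..N. measure lebesgue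
      ({t. unit_dir t \<in> normal_cone (closure \<Omega>) (v j)} \<inter> {0..2 * pi}))"
    by (intro sum.cong refl interior_angle_bounds(3)[symmetric] v(2) P)
  also have "\<dots> = 2 * pi"
    using sum.reindex_bij_betw[OF v(1), of "\<lambda>v. measure lebesgue
      ({t. unit_dir t \<in> normal_cone (closure \<Omega>) v} \<inter> {0..2 * pi})"] sum_measure_normal_cones[OF P]
    by simp
  finally show ?thesis .
qed

section \<open>Normals of a smooth domain\<close>

lemma planar_isometry_affine:
  assumes "planar_isometry T"
  obtains g b where "orthogonal_transformation g" "T = (\<lambda>x. g x + b)"
proof -
  have ex: "\<exists>g b. orthogonal_transformation g \<and> T = (\<lambda>x. g x + b)"
    using assms
  proof induction
    case (translation a)
    show ?case
      by (intro exI[of _ id] exI[of _ a]) (auto simp: orthogonal_transformation_id add.commute)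
  next
    case (rotation A)
    then show ?case
      by (intro exI[of _ "(*v) A"] exI[of _ 0])
        (auto simp: rotation_matrix_def orthogonal_transformation_matrix)
  next
    case (reflection A)
    then show ?case
      by (intro exI[of _ "(*v) A"] exI[of _ 0])
        (auto simp: rotoinversion_matrix_def orthogonal_transformation_matrix)
  next
    case (composition S T)
    then obtain g b h c where "orthogonal_transformation g" "S = (\<lambda>x. g x + b)"
      "orthogonal_transformation h" "T = (\<lambda>x. h x + c)" by blast
    then show ?case
      using orthogonal_transformation_compose[of g h]
      by (intro exI[of _ "g \<circ> h"] exI[of _ "g c + b"])
        (auto simp: orthogonal_transformation_linear linear_add o_def)
  qed
  then show ?thesis using that by blast
qed

text \<open>In the coordinates of the local graph, moving along the graph shows that a normal at the boundary
  point annihilates the tangent vector \<open>(1, f')\<close>, and moving up shows that its second component is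
  not positive. Together with the norm these conditions determine it.\<close>

lemma unique_unit_normal:
  fixes y m n :: "real^2"
  assumes "smooth_boundary \<Omega>" "open \<Omega>" "y \<in> closure \<Omega>"
    and "norm m = 1" "m \<in> normal_cone (closure \<Omega>) y" "norm n = 1" "n \<in> normal_cone (closure \<Omega>) y"
  shows "m = n"
proof -
  have "y \<notin> \<Omega>"
  proof
    assume "y \<in> \<Omega>"
    then obtain e where e: "e > 0" "cball y e \<subseteq> \<Omega>"
      using \<open>open \<Omega>\<close> open_contains_cball by blast
    have "y + e *\<^sub>R m \<in> closure \<Omega>"
      using e \<open>norm m = 1\<close> by (intro subsetD[OF closure_subset] subsetD[OF e(2)]) (simp add: dist_norm)
    then have "m \<bullet> (e *\<^sub>R m) \<le> 0" using assms(5) by (force simp: normal_cone_def)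
    moreover have "m \<bullet> m = 1" using \<open>norm m = 1\<close> by (simp add: norm_eq_1)
    ultimately show False using e by simp
  qed
  then have "y \<in> frontier \<Omega>" using assms by (simp add: frontier_def interior_open)
  then obtain r T f where r: "r > 0" and T: "planar_isometry T" and f: "smooth_function f"
    and graph: "\<Omega> \<inter> ball y r = {x \<in> ball y r. f (T x $ 1) < T x $ 2}"
    using assms(1) unfolding smooth_boundary_def by blast
  obtain g b where g: "orthogonal_transformation g" and Tg: "T = (\<lambda>x. g x + b)"
    using planar_isometry_affine[OF T] .
  have glin: "linear g" using g by (rule orthogonal_transformation_linear)
  have contg: "continuous_on UNIV g" using glin by (simp add: linear_continuous_on linear_conv_bounded_linear)
  have fdiff: "f differentiable at x" for x
    using f[unfolded smooth_function_def, rule_format, of 0 x] by simp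
  then have fcont: "continuous_on A f" for A
    by (simp add: continuous_at_imp_continuous_on differentiable_imp_continuous_within)
  define q where "q = T y"
  define D where "D = deriv f (q $ 1)"
  have D: "(f has_real_derivative D) (at (q $ 1))"
    using fdiff[of "q $ 1"] unfolding D_def
    by (simp add: DERIV_deriv_iff_real_differentiable)
  have "\<not> f (q $ 1) < q $ 2"
  proof
    assume "f (q $ 1) < q $ 2"
    then have "y \<in> {x \<in> ball y r. f (T x $ 1) < T x $ 2}" using r by (simp add: q_def)
    then show False using \<open>y \<notin> \<Omega>\<close> graph by blast
  qed
  moreover have "\<not> q $ 2 < f (q $ 1)"
  proof
    assume less: "q $ 2 < f (q $ 1)"
    have "open {x. T x $ 2 < f (T x $ 1)}"
      unfolding Tg by (intro open_Collect_less continuous_on_compose2[OF fcont[of UNIV]] continuous_intros contg) auto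
    then have "open (ball y r \<inter> {x. T x $ 2 < f (T x $ 1)})" by auto
    moreover have "y \<in> (ball y r \<inter> {x. T x $ 2 < f (T x $ 1)}) \<inter> closure \<Omega>"
      using less r assms(3) by (simp add: q_def)
    ultimately have "(ball y r \<inter> {x. T x $ 2 < f (T x $ 1)}) \<inter> \<Omega> \<noteq> {}"
      by (subst open_Int_closure_eq_empty[symmetric]) blast+
    then obtain x where "x \<in> \<Omega> \<inter> ball y r" "T x $ 2 < f (T x $ 1)" by blast
    then show False unfolding graph by simp
  qed
  ultimately have q2: "q $ 2 = f (q $ 1)" by simp
  have normal: "g u $ 1 = - D * g u $ 2 \<and> g u $ 2 \<le> 0 \<and> (g u $ 1)\<^sup>2 + (g u $ 2)\<^sup>2 = 1"
    if "norm u = 1" "u \<in> normal_cone (closure \<Omega>) y" for u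
  proof -
    have above: "g u $ 1 * s + g u $ 2 * t \<le> 0"
      if st: "norm (vector [s, t] :: real^2) < r" "f (q $ 1 + s) < f (q $ 1) + t" for s t
    proof -
      define w :: "real^2" where "w = vector [s, t]"
      obtain x' where x': "w = g x'" using orthogonal_transformation_surj[OF g] by (metis surj_def)
      have "norm x' = norm w" using g x' by (simp add: orthogonal_transformation_norm)
      then have "y + x' \<in> ball y r" using st by (simp add: w_def dist_norm)
      moreover have "T (y + x') = q + w"
        by (simp add: Tg q_def x' linear_add[OF glin])
      ultimately have "y + x' \<in> {x \<in> ball y r. f (T x $ 1) < T x $ 2}"
        using st(2) q2 by (simp add: w_def)
      then have "y + x' \<in> \<Omega>" using graph by blast
      then have "u \<bullet> x' \<le> 0" using that \<open>u \<in> _\<close> closure_subset by (force simp: normal_cone_def)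
      then have "g u \<bullet> w \<le> 0" using g by (simp add: x' orthogonal_transformation_def)
      then show ?thesis by (simp add: w_def inner_vec_def sum_2)
    qed
    have "norm (vector [0, r / 2] :: real^2) < r"
      using r by (simp add: norm_vec_def L2_set_def sum_2)
    then have "g u $ 2 * (r / 2) \<le> 0" using above[of 0 "r / 2"] r by simp
    then have le: "g u $ 2 \<le> 0" using r by (simp add: mult_le_0_iff)
    have tend: "((\<lambda>t. norm (vector [t, f (q $ 1 + t) - f (q $ 1)] :: real^2)) \<longlongrightarrow> 0) (at 0)"
    proof -
      have "((\<lambda>t. f (q $ 1 + t)) \<longlongrightarrow> f (q $ 1)) (at 0)"
        using DERIV_isCont[OF D] by (simp add: isCont_iff)
      then have "((\<lambda>t. sqrt (t\<^sup>2 + (f (q $ 1 + t) - f (q $ 1))\<^sup>2)) \<longlongrightarrow> sqrt (0\<^sup>2 + (f (q $ 1) - f (q $ 1))\<^sup>2)) (at 0)"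
        by (intro tendsto_intros)
      then show ?thesis by (simp add: norm_vec_def L2_set_def sum_2)
    qed
    then obtain d where d: "d > 0"
      "\<And>t. t \<noteq> 0 \<Longrightarrow> \<bar>t\<bar> < d \<Longrightarrow> norm (vector [t, f (q $ 1 + t) - f (q $ 1)] :: real^2) < r"
      using order_tendstoD(2)[OF tend r] unfolding eventually_at by (auto simp: dist_real_def)
    \<comment> \<open>The graph itself lies outside the open region, so \<open>\<phi> \<le> 0\<close> is reached as a limit of
      points slightly above the graph.\<close>
    define \<phi> where "\<phi> t = g u $ 1 * t + g u $ 2 * (f (q $ 1 + t) - f (q $ 1))" for t
    have "\<phi> t \<le> 0" if "\<bar>t\<bar> < d" for t
    proof (cases "t = 0")
      case False
      have "((\<lambda>s. sqrt (t\<^sup>2 + (f (q $ 1 + t) - f (q $ 1) + s)\<^sup>2)) \<longlongrightarrow>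
          sqrt (t\<^sup>2 + (f (q $ 1 + t) - f (q $ 1) + 0)\<^sup>2)) (at_right 0)"
        by (intro tendsto_intros)
      then have "((\<lambda>s. norm (vector [t, f (q $ 1 + t) - f (q $ 1) + s] :: real^2)) \<longlongrightarrow>
          norm (vector [t, f (q $ 1 + t) - f (q $ 1)] :: real^2)) (at_right 0)"
        by (simp add: norm_vec_def L2_set_def sum_2)
      then have "\<forall>\<^sub>F s in at_right 0. norm (vector [t, f (q $ 1 + t) - f (q $ 1) + s] :: real^2) < r"
        using d(2)[OF False that] by (intro order_tendstoD(2)) auto
      then have "\<forall>\<^sub>F s in at_right 0. g u $ 1 * t + g u $ 2 * (f (q $ 1 + t) - f (q $ 1) + s) \<le> 0"
        using eventually_at_right_less[of 0] by eventually_elim (rule above, auto)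
      moreover have "((\<lambda>s. g u $ 1 * t + g u $ 2 * (f (q $ 1 + t) - f (q $ 1) + s)) \<longlongrightarrow>
          g u $ 1 * t + g u $ 2 * (f (q $ 1 + t) - f (q $ 1) + 0)) (at_right 0)"
        by (intro tendsto_intros)
      ultimately show ?thesis
        unfolding \<phi>_def by (auto dest: tendsto_upperbound)
    qed (simp add: \<phi>_def)
    moreover have shifted: "((\<lambda>t. f (q $ 1 + t)) has_real_derivative D) (at 0)"
      using D DERIV_shift[of f D 0 "q $ 1"] by (simp add: add.commute)
    have "(\<phi> has_real_derivative g u $ 1 * 1 + g u $ 2 * (D - 0)) (at 0)"
      unfolding \<phi>_def by (intro DERIV_add DERIV_cmult DERIV_ident DERIV_diff DERIV_const shifted)
    then have "(\<phi> has_real_derivative g u $ 1 + g u $ 2 * D) (at 0)" by simp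
    ultimately have "g u $ 1 + g u $ 2 * D = 0"
      using d(1) by (intro DERIV_local_max[of \<phi> _ 0 d]) (auto simp: \<phi>_def)
    moreover have "norm (g u) = 1" using g that by (simp add: orthogonal_transformation_norm)
    then have "(g u $ 1)\<^sup>2 + (g u $ 2)\<^sup>2 = 1" by (simp add: norm_eq_1 inner_vec_def sum_2 power2_eq_square)
    ultimately show ?thesis using le by (simp add: add_eq_0_iff2 mult.commute)
  qed
  have *: "(g u $ 2)\<^sup>2 = 1 / (1 + D\<^sup>2)" if "norm u = 1" "u \<in> normal_cone (closure \<Omega>) y" for u
  proof -
    have "(g u $ 2)\<^sup>2 * (1 + D\<^sup>2) = 1"
      using normal[OF that] by (auto simp: power_mult_distrib algebra_simps)
    then show ?thesis by (metis eq_divide_eq mult_zero_right zero_neq_one)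
  qed
  have "\<bar>g m $ 2\<bar> = \<bar>g n $ 2\<bar>" using *[OF assms(4,5)] *[OF assms(6,7)] by (metis real_sqrt_abs)
  then have "g m $ 2 = g n $ 2" using normal[OF assms(4,5)] normal[OF assms(6,7)] by auto
  then have "g m = g n" using normal[OF assms(4,5)] normal[OF assms(6,7)] by (simp add: vec_eq_iff forall_2)
  then show ?thesis using orthogonal_transformation_inj[OF g] by (metis injD)
qed

section \<open>Angles of polygons close to a smooth domain\<close>

text \<open>Compactness makes the real-valued suprema bounded, so that they really bound every distance.\<close>

lemma hausdorff_distD:
  assumes "compact X" "compact Y" "X \<noteq> {}" "Y \<noteq> {}" "hausdorff_dist X Y < \<delta>"
  shows "\<And>x. x \<in> X \<Longrightarrow> \<exists>y\<in>Y. norm (x - y) < \<delta>"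
    and "\<And>y. y \<in> Y \<Longrightarrow> \<exists>x\<in>X. norm (x - y) < \<delta>"
proof -
  have *: "\<exists>y\<in>Y. norm (x - y) < \<delta>"
    if "compact X" "Y \<noteq> {}" "(SUP x\<in>X. INF y\<in>Y. norm (x - y)) < \<delta>" "x \<in> X" for X Y :: "(real^2) set" and x
  proof -
    have inf: "(INF y\<in>Y. norm (x - y)) = infdist x Y" for x
      using \<open>Y \<noteq> {}\<close> by (simp add: infdist_def dist_norm)
    have "compact ((\<lambda>x. infdist x Y) ` X)"
      by (intro compact_continuous_image \<open>compact X\<close> continuous_intros)
    then have "bdd_above ((\<lambda>x. infdist x Y) ` X)"
      by (intro bounded_imp_bdd_above compact_imp_bounded)
    then have "infdist x Y \<le> (SUP x\<in>X. infdist x Y)"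
      using \<open>x \<in> X\<close> by (rule cSUP_upper[rotated])
    then have "(INF y\<in>Y. norm (x - y)) < \<delta>" using that(3) by (simp add: inf)
    then show ?thesis using \<open>Y \<noteq> {}\<close> by (auto dest!: cInf_lessD[rotated])
  qed
  show "\<exists>y\<in>Y. norm (x - y) < \<delta>" if "x \<in> X" for x
    using assms that by (intro *[of X Y]) (auto simp: hausdorff_dist_def)
  show "\<exists>x\<in>X. norm (x - y) < \<delta>" if "y \<in> Y" for y
    using assms that *[of Y X y] by (auto simp: hausdorff_dist_def norm_minus_commute)
qed

text \<open>Pulling the normals of \<open>P\<close> back along \<open>S\<close> preserves their inner product, and each of the two
  comparisons of points of \<open>P\<close> with points of \<open>K\<close> costs at most \<open>\<delta>\<close>.\<close>

lemma approximate_normals: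
  assumes "compact P" "compact K" "P \<noteq> {}" "K \<noteq> {}" "planar_isometry T" "planar_isometry S"
    and dist: "hausdorff_dist (T ` P) (S ` K) < \<delta>"
    and v: "v \<in> P" and n: "norm n1 = 1" "n1 \<in> normal_cone P v" "norm n2 = 1" "n2 \<in> normal_cone P v"
  obtains y m1 m2 where "y \<in> K" "norm m1 = 1" "norm m2 = 1" "m1 \<bullet> m2 = n1 \<bullet> n2"
    "\<And>z. z \<in> K \<Longrightarrow> m1 \<bullet> (z - y) \<le> 2 * \<delta>" "\<And>z. z \<in> K \<Longrightarrow> m2 \<bullet> (z - y) \<le> 2 * \<delta>"
proof -
  obtain g b where g: "orthogonal_transformation g" and Tg: "T = (\<lambda>x. g x + b)"
    using planar_isometry_affine[OF \<open>planar_isometry T\<close>] .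
  obtain h c where h: "orthogonal_transformation h" and Sh: "S = (\<lambda>x. h x + c)"
    using planar_isometry_affine[OF \<open>planar_isometry S\<close>] .
  have lin: "linear g" "linear h" using g h by (auto simp: orthogonal_transformation_linear)
  have "compact (T ` P)" "compact (S ` K)"
    unfolding Tg Sh using lin assms(1,2)
    by (intro compact_continuous_image continuous_on_add continuous_on_const linear_continuous_on;
        simp add: linear_conv_bounded_linear)+
  note D = hausdorff_distD[OF this _ _ dist]
  obtain y where y: "y \<in> K" "norm (T v - S y) < \<delta>" using D(1)[of "T v"] v assms by auto
  have key: "\<exists>m. h m = g u \<and> norm m = 1 \<and> (\<forall>z\<in>K. m \<bullet> (z - y) \<le> 2 * \<delta>)"
    if u: "norm u = 1" "u \<in> normal_cone P v" for u
  proof -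
    obtain m where m: "h m = g u" using orthogonal_transformation_surj[OF h] by (metis surj_def)
    have gu: "norm (g u) = 1" using u g by (simp add: orthogonal_transformation_norm)
    have "norm m = 1" using m gu h by (metis orthogonal_transformation_norm)
    moreover have "m \<bullet> (z - y) \<le> 2 * \<delta>" if "z \<in> K" for z
    proof -
      obtain x where x: "x \<in> P" "norm (T x - S z) < \<delta>" using D(2)[of "S z"] \<open>z \<in> K\<close> assms by auto
      have "m \<bullet> (z - y) = h m \<bullet> h (z - y)" using h by (simp add: orthogonal_transformation_def)
      also have "\<dots> = g u \<bullet> (S z - S y)" by (simp add: m Sh linear_diff[OF lin(2)])
      also have "\<dots> = g u \<bullet> (T v - S y) - g u \<bullet> (T x - S z) + g u \<bullet> (T x - T v)"
        by (simp add: inner_diff_right)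
      also have "g u \<bullet> (T x - T v) = g u \<bullet> g (x - v)" by (simp add: Tg linear_diff[OF lin(1)])
      also have "\<dots> = u \<bullet> (x - v)" using g by (simp add: orthogonal_transformation_def)
      also have "\<dots> \<le> 0" using u x by (simp add: normal_cone_def)
      finally have "m \<bullet> (z - y) \<le> \<bar>g u \<bullet> (T v - S y)\<bar> + \<bar>g u \<bullet> (T x - S z)\<bar>" by linarith
      also have "\<dots> \<le> norm (T v - S y) + norm (T x - S z)"
        using Cauchy_Schwarz_ineq2[of "g u" "T v - S y"] Cauchy_Schwarz_ineq2[of "g u" "T x - S z"] gu by simp
      finally show ?thesis using x y by simp
    qed
    ultimately show ?thesis using m by blast
  qed
  obtain m1 where m1: "h m1 = g n1" "norm m1 = 1" "\<forall>z\<in>K. m1 \<bullet> (z - y) \<le> 2 * \<delta>"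
    using key[OF n(1,2)] by blast
  obtain m2 where m2: "h m2 = g n2" "norm m2 = 1" "\<forall>z\<in>K. m2 \<bullet> (z - y) \<le> 2 * \<delta>"
    using key[OF n(3,4)] by blast
  have "m1 \<bullet> m2 = h m1 \<bullet> h m2" using h by (simp add: orthogonal_transformation_def)
  also have "\<dots> = n1 \<bullet> n2" using g by (simp add: m1 m2 orthogonal_transformation_def)
  finally show ?thesis using that y m1 m2 by blast
qed

text \<open>Otherwise there would be, for arbitrarily small \<open>\<delta>\<close>, a point of the closed domain with two unit
  vectors that are \<open>2 * \<delta>\<close>-almost normal there and have inner product at most \<open>c\<close>. Such triples form a
  decreasing sequence of non-empty compact sets, and a common element would be a boundary point with
  two distinct unit normals.\<close>

lemma normals_close_near_smooth_domain:
  assumes \<Omega>: "open \<Omega>" "bounded \<Omega>" "\<Omega> \<noteq> {}" "smooth_boundary \<Omega>" and "c < 1"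
  shows "\<exists>\<delta>>0. \<forall>P T S v m n. compact P \<and> planar_isometry T \<and> planar_isometry S \<and>
      hausdorff_dist (T ` P) (S ` closure \<Omega>) < \<delta> \<and> v \<in> P \<and>
      norm m = 1 \<and> m \<in> normal_cone P v \<and> norm n = 1 \<and> n \<in> normal_cone P v \<longrightarrow> c < m \<bullet> n"
proof (rule ccontr)
  assume no: "\<not> ?thesis"
  let ?K = "closure \<Omega>"
  have K: "compact ?K" "?K \<noteq> {}" using \<Omega> by auto
  define F where "F k = (?K \<times> sphere 0 1 \<times> sphere 0 1) \<inter>
      ({x. fst (snd x) \<bullet> snd (snd x) \<le> c} \<inter>
       (\<Inter>z\<in>?K. {x. fst (snd x) \<bullet> (z - fst x) \<le> 2 * inverse (real (Suc k))} \<inter>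
         {x. snd (snd x) \<bullet> (z - fst x) \<le> 2 * inverse (real (Suc k))}))" for k :: nat
  have "\<Inter>(range F) \<noteq> {}"
  proof (rule compact_nest)
    fix k
    show "compact (F k)"
      unfolding F_def
      by (intro compact_Int_closed compact_Times K compact_sphere closed_Int closed_INT ballI
          closed_Collect_le continuous_intros)
    obtain P T S v m n where *: "compact P" "planar_isometry T" "planar_isometry S"
      "hausdorff_dist (T ` P) (S ` ?K) < inverse (real (Suc k))"
      "v \<in> P" "norm m = 1" "m \<in> normal_cone P v" "norm n = 1" "n \<in> normal_cone P v" "\<not> c < m \<bullet> n"
      using no[unfolded not_ex de_Morgan_conj, rule_format, of "inverse (real (Suc k))"]
      unfolding not_all not_imp by (auto simp del: of_nat_Suc)
    then obtain y m1 m2 where "y \<in> ?K" "norm m1 = 1" "norm m2 = 1" "m1 \<bullet> m2 = m \<bullet> n"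
      "\<And>z. z \<in> ?K \<Longrightarrow> m1 \<bullet> (z - y) \<le> 2 * inverse (real (Suc k))" "\<And>z. z \<in> ?K \<Longrightarrow> m2 \<bullet> (z - y) \<le> 2 * inverse (real (Suc k))"
      using approximate_normals[of P ?K T S "inverse (real (Suc k))" v m n] K by blast
    with * have "(y, m1, m2) \<in> F k" by (simp add: F_def)
    then show "F k \<noteq> {}" by blast
  next
    fix k l :: nat assume "k \<le> l"
    then have "inverse (real (Suc l)) \<le> inverse (real (Suc k))" by simp
    then have "a \<le> 2 * inverse (real (Suc l)) \<Longrightarrow> a \<le> 2 * inverse (real (Suc k))" for a
      by linarith
    then show "F l \<subseteq> F k" unfolding F_def by blast
  qed
  then obtain y m n where F: "\<And>k. (y, m, n) \<in> F k" by (metis INT_E equals0I prod_cases3 rangeI InterE)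
  have lim: "a \<le> 0" if "\<And>k::nat. a \<le> 2 * inverse (real (Suc k))" for a :: real
  proof (rule LIMSEQ_le_const)
    show "(\<lambda>k::nat. 2 * inverse (real (Suc k))) \<longlonglongrightarrow> 0"
      using tendsto_mult_right_zero[OF LIMSEQ_inverse_real_of_nat] .
  qed (use that in auto)
  have "m \<in> normal_cone ?K y" "n \<in> normal_cone ?K y"
    unfolding normal_cone_def using F by (auto simp: F_def intro!: lim)
  moreover have "y \<in> ?K" "norm m = 1" "norm n = 1" "m \<bullet> n \<le> c" using F[of 0] by (auto simp: F_def)
  ultimately have "m = n" using unique_unit_normal[OF \<Omega>(4,1)] by blast
  then have "m \<bullet> n = 1" using \<open>norm m = 1\<close> by (simp add: norm_eq_1)
  then show False using \<open>m \<bullet> n \<le> c\<close> \<open>c < 1\<close> by simp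
qed

text \<open>Passing to the infimum over isometries is harmless because \<open>\<delta>\<close> above was chosen uniformly in the
  isometries: at each stage some pair \<open>T\<close>, \<open>S\<close> comes within \<open>\<delta>\<close>.\<close>

lemma interior_angles_tend_to_pi:
  fixes \<eta> :: real
  assumes poly: "\<And>k. convex_polygonal_domain (\<Omega>s k)" "\<And>k. has_sides_and_interior_angles (\<Omega>s k) (N k) (\<theta> k)"
    and \<Omega>: "open \<Omega>" "bounded \<Omega>" "\<Omega> \<noteq> {}" "smooth_boundary \<Omega>"
    and conv: "hausdorff_converges (\<lambda>k. closure (\<Omega>s k)) (closure \<Omega>)" and "\<eta> > 0"
  shows "\<forall>\<^sub>F k in sequentially. \<forall>j\<in>{1..N k}. pi - \<eta> < \<theta> k j \<and> \<theta> k j \<le> pi"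
proof -
  define \<eta>' where "\<eta>' = min \<eta> pi"
  have \<eta>': "0 < \<eta>'" "\<eta>' \<le> pi" "\<eta>' \<le> \<eta>" using \<open>\<eta> > 0\<close> by (auto simp: \<eta>'_def)
  have "cos \<eta>' < 1" using \<eta>' cos_monotone_0_pi[of 0 \<eta>'] by simp
  then obtain \<delta> where \<delta>: "\<delta> > 0"
    and close: "\<forall>P T S v m n. compact P \<and> planar_isometry T \<and> planar_isometry S \<and>
      hausdorff_dist (T ` P) (S ` closure \<Omega>) < \<delta> \<and> v \<in> P \<and>
      norm m = 1 \<and> m \<in> normal_cone P v \<and> norm n = 1 \<and> n \<in> normal_cone P v \<longrightarrow> cos \<eta>' < m \<bullet> n"
    using normals_close_near_smooth_domain[OF \<Omega>, of "cos \<eta>'"] by meson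
  have "\<forall>\<^sub>F k in sequentially. hausdorff_dist_mod_isometry (closure (\<Omega>s k)) (closure \<Omega>) < \<delta>"
    using conv \<delta> unfolding hausdorff_converges_def by (rule order_tendstoD(2))
  then show ?thesis
  proof eventually_elim
    case (elim k)
    have P: "polytope (closure (\<Omega>s k))" using poly(1) by (simp add: convex_polygonal_domain_def)
    have "{(T, S). planar_isometry T \<and> planar_isometry S} \<noteq> {}"
      using translation by blast
    with elim obtain T S where TS: "planar_isometry T" "planar_isometry S"
      "hausdorff_dist (T ` closure (\<Omega>s k)) (S ` closure \<Omega>) < \<delta>"
      unfolding hausdorff_dist_mod_isometry_def by (auto dest!: cInf_lessD[rotated])
    obtain v where v: "bij_betw v {1..N k} {x. x extreme_point_of closure (\<Omega>s k)}"
      "\<And>j. j \<in> {1..N k} \<Longrightarrow> has_interior_angle (\<Omega>s k) (v j) (\<theta> k j)"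
      using poly(2)[of k] by (auto simp: has_sides_and_interior_angles_def)
    show ?case
    proof
      fix j assume j: "j \<in> {1..N k}"
      note A = interior_angle_bounds[OF v(2)[OF j] P]
      have "v j \<in> closure (\<Omega>s k)"
        using bij_betwE[OF v(1)] j by (auto simp: extreme_point_of_def)
      moreover obtain m n where "m \<in> normal_cone (closure (\<Omega>s k)) (v j)" "norm m = 1"
        "n \<in> normal_cone (closure (\<Omega>s k)) (v j)" "norm n = 1" "m \<bullet> n = - cos (\<theta> k j)"
        using A(4) by blast
      ultimately have "cos \<eta>' < - cos (\<theta> k j)"
        using close[rule_format, of "closure (\<Omega>s k)" T S "v j" m n] polytope_imp_compact[OF P] TS by simp
      also have "\<dots> = cos (pi - \<theta> k j)" by simp
      finally have "pi - \<theta> k j < \<eta>'"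
        using A(1,2) \<eta>' cos_monotone_0_pi_le[of \<eta>' "pi - \<theta> k j"] by (force simp: not_less)
      then show "pi - \<eta> < \<theta> k j \<and> \<theta> k j \<le> pi" using A \<eta>' by auto
    qed
  qed
qed

section \<open>The contribution of an almost flat corner\<close>

text \<open>This makes both \<open>1 / (1 + cosh s)\<close> and its square polynomials in \<open>tanh (s / 2)\<close>, and hence
  derivatives of such polynomials.\<close>

lemma one_plus_cosh: "1 + cosh s = 2 / (1 - (tanh (s / 2))\<^sup>2)" for s :: real
proof -
  have c: "cosh (s / 2) \<noteq> 0" by simp
  have "1 - (tanh (s / 2))\<^sup>2 = 1 / (cosh (s / 2))\<^sup>2"
    using c unfolding tanh_def power_divide sinh_square_eq by (simp add: diff_divide_distrib)
  moreover have "1 + cosh s = 2 * (cosh (s / 2))\<^sup>2"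
    using cosh_double_cosh[of "s / 2"] by simp
  ultimately show ?thesis by simp
qed

lemma cosh_plus_one_pos: "0 < 1 + cosh s" for s :: real
  using cosh_real_ge_1[of s] by linarith

lemma tanh_half_limits:
  "((\<lambda>s::real. tanh (s / 2)) \<longlongrightarrow> 1) at_top" "((\<lambda>s::real. tanh (s / 2)) \<longlongrightarrow> -1) at_bot"
proof -
  have "filterlim (\<lambda>s::real. s / 2) at_top at_top" "filterlim (\<lambda>s::real. s / 2) at_bot at_bot"
    using filterlim_tendsto_pos_mult_at_top[OF tendsto_const _ filterlim_ident, of "1 / 2 :: real"]
      filterlim_tendsto_pos_mult_at_bot[OF tendsto_const _ filterlim_ident, of "1 / 2 :: real"] by simp_all
  then show "((\<lambda>s::real. tanh (s / 2)) \<longlongrightarrow> 1) at_top" "((\<lambda>s::real. tanh (s / 2)) \<longlongrightarrow> -1) at_bot"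
    using filterlim_compose[OF tanh_real_at_top] filterlim_compose[OF tanh_real_at_bot] by blast+
qed

lemma has_real_derivative_tanh_half:
  "((\<lambda>s. tanh (s / 2)) has_real_derivative (1 - (tanh (s / 2))\<^sup>2) * (1 / 2)) (at s)"
  by (rule has_field_derivative_tanh) (auto intro!: derivative_eq_intros)

lemma whole_line_FTC:
  fixes f F :: "real \<Rightarrow> real"
  assumes "\<And>x. (F has_real_derivative f x) (at x)" "\<And>x. isCont f x" "\<And>x. 0 \<le> f x"
    and "(F \<longlongrightarrow> A) at_bot" "(F \<longlongrightarrow> B) at_top"
  shows "integrable lborel f" "(LBINT x. f x) = B - A"
proof -
  have e: "einterval (-\<infinity>) \<infinity> = (UNIV :: real set)" by (auto simp: einterval_def)
  have "set_integrable lborel (einterval (-\<infinity>) \<infinity>) f" "(LBINT x=-\<infinity>..\<infinity>. f x) = B - A"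
    by (rule interval_integral_FTC_nonneg[where F = F]; use assms in \<open>simp add: ereal_tendsto_simps\<close>)+
  then show "integrable lborel f" "(LBINT x. f x) = B - A"
    by (simp_all add: e set_integrable_def interval_lebesgue_integral_def set_lebesgue_integral_def)
qed

lemma integrable_inverse_one_plus_cosh: "integrable lborel (\<lambda>s::real. 1 / (1 + cosh s))"
proof (rule whole_line_FTC(1))
  show "((\<lambda>s. tanh (s / 2)) has_real_derivative 1 / (1 + cosh s)) (at s)" for s :: real
    using has_real_derivative_tanh_half[of s] by (simp add: one_plus_cosh)
  show "isCont (\<lambda>s::real. 1 / (1 + cosh s)) s" for s
    using cosh_plus_one_pos[of s] by (intro continuous_intros) auto
qed (use cosh_plus_one_pos tanh_half_limits in \<open>auto intro: less_imp_le\<close>)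

lemma integral_inverse_one_plus_cosh_squared: "(LBINT s. 1 / (1 + cosh s)\<^sup>2) = (2 / 3 :: real)"
proof -
  \<comment> \<open>With \<open>T = tanh (s / 2)\<close> the integrand is \<open>(1 - T\<^sup>2)\<^sup>2 / 4\<close> and \<open>T\<close> has derivative \<open>(1 - T\<^sup>2) / 2\<close>, so an
    antiderivative is half that of \<open>1 - T\<^sup>2\<close> as a polynomial in \<open>T\<close>.\<close>
  define F where "F s = (tanh (s / 2) - (tanh (s / 2))^3 / 3) / 2" for s :: real
  have "(LBINT s. 1 / (1 + cosh s)\<^sup>2) = (1 - 1^3 / 3) / 2 - (-1 - (-1)^3 / 3) / (2::real)"
  proof (rule whole_line_FTC(2))
    fix s :: real
    define x where "x = (tanh (s / 2))\<^sup>2"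
    have "((\<lambda>s. tanh (s / 2)) has_real_derivative (1 - x) * (1 / 2)) (at s)"
      unfolding x_def by (rule has_real_derivative_tanh_half)
    note DERIV_cdivide[OF DERIV_diff[OF this DERIV_cdivide[OF DERIV_power[OF this, of 3], of 3]], of 2]
    moreover have "((1 - x) * (1 / 2) - real 3 * ((1 - x) * (1 / 2) * tanh (s / 2) ^ (3 - Suc 0)) / 3) / 2
        = 1 / (1 + cosh s)\<^sup>2"
      by (simp add: one_plus_cosh x_def[symmetric] power_divide) (simp add: power2_eq_square field_simps)
    ultimately show "(F has_real_derivative 1 / (1 + cosh s)\<^sup>2) (at s)"
      unfolding F_def by simp
    show "isCont (\<lambda>s::real. 1 / (1 + cosh s)\<^sup>2) s"
      using cosh_plus_one_pos[of s] by (intro continuous_intros) auto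
    show "(F \<longlongrightarrow> (1 - 1^3 / 3) / 2) at_top" "(F \<longlongrightarrow> (-1 - (-1)^3 / 3) / 2) at_bot"
      unfolding F_def by (intro tendsto_intros tanh_half_limits; simp)+
    show "0 \<le> 1 / (1 + cosh s)\<^sup>2" by simp
  qed
  then show ?thesis by simp
qed

text \<open>For these angles \<open>pi\<^sup>2 / \<alpha>\<close> lies between \<open>pi\<close> and \<open>3 * pi / 2\<close>, so the cosine in the denominator is
  not positive and the second factor is at least 1.\<close>

lemma corner_integrand_bound:
  assumes "2 * pi / 3 \<le> \<alpha>" "\<alpha> \<le> pi"
  shows "\<bar>corner_integrand \<alpha> s\<bar> \<le> 1 / (1 + cosh s)"
proof -
  have \<alpha>: "\<alpha> > 0" using assms pi_gt_zero by linarith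
  have "pi \<le> pi\<^sup>2 / \<alpha>" "pi\<^sup>2 / \<alpha> \<le> 3 * pi / 2"
    using \<alpha> assms by (simp_all add: field_simps power2_eq_square)
  then have "0 \<le> cos (pi\<^sup>2 / \<alpha> - pi)" by (intro cos_ge_zero) auto
  then have "cos (pi\<^sup>2 / \<alpha>) \<le> 0" by (simp add: cos_diff)
  then have "1 \<le> cosh (pi * s / \<alpha>) - cos (pi\<^sup>2 / \<alpha>)"
    using cosh_real_ge_1[of "pi * s / \<alpha>"] by linarith
  then have "1 + cosh s \<le> (1 + cosh s) * (cosh (pi * s / \<alpha>) - cos (pi\<^sup>2 / \<alpha>))"
    using cosh_plus_one_pos[of s] by (simp add: mult_le_cancel_left1)
  then show ?thesis
    unfolding corner_integrand_def using cosh_plus_one_pos[of s]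
    by (auto simp: abs_of_pos intro!: divide_left_mono)
qed

lemma borel_measurable_corner_integrand [measurable]: "corner_integrand \<alpha> \<in> borel_measurable lborel"
proof -
  have [measurable]: "(cosh :: real \<Rightarrow> real) \<in> borel_measurable borel"
    by (intro borel_measurable_continuous_onI continuous_intros)
  show ?thesis unfolding corner_integrand_def[abs_def] by measurable
qed

lemma integrable_corner_integrand:
  assumes "2 * pi / 3 \<le> \<alpha>" "\<alpha> \<le> pi"
  shows "integrable lborel (corner_integrand \<alpha>)"
  by (rule Bochner_Integration.integrable_bound[OF integrable_inverse_one_plus_cosh])
     (use corner_integrand_bound[OF assms] cosh_plus_one_pos in \<open>auto simp: abs_of_pos\<close>)

text \<open>At \<open>\<alpha> = pi\<close> the cosine equals \<open>-1\<close> and the integrand becomes \<open>1 / (1 + cosh s)\<^sup>2\<close>.\<close>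

lemma tendsto_corner_integral:
  "((\<lambda>\<alpha>. LBINT s. corner_integrand \<alpha> s) \<longlongrightarrow> 2 / 3) (at_left pi)"
  unfolding tendsto_at_iff_sequentially
proof (intro allI impI)
  fix X :: "nat \<Rightarrow> real"
  assume X: "\<forall>i. X i \<in> {..<pi} - {pi}" and lim: "X \<longlonglongrightarrow> pi"
  have "\<forall>\<^sub>F n in sequentially. 2 * pi / 3 < X n"
    using lim by (rule order_tendstoD) simp
  then obtain n0 where n0: "\<And>n. n \<ge> n0 \<Longrightarrow> 2 * pi / 3 < X n"
    unfolding eventually_sequentially by auto
  have "(\<lambda>n. LBINT s. corner_integrand (X (n + n0)) s) \<longlonglongrightarrow> (LBINT s. 1 / (1 + cosh s)\<^sup>2)"
  proof (rule integral_dominated_convergence[OF _ _ integrable_inverse_one_plus_cosh])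
    have [measurable]: "(cosh :: real \<Rightarrow> real) \<in> borel_measurable borel"
      by (intro borel_measurable_continuous_onI continuous_intros)
    show "(\<lambda>s::real. 1 / (1 + cosh s)\<^sup>2) \<in> borel_measurable lborel" by measurable
    have lim': "(\<lambda>n. X (n + n0)) \<longlonglongrightarrow> pi" using lim by (rule LIMSEQ_ignore_initial_segment)
    have "(\<lambda>n. corner_integrand (X (n + n0)) s) \<longlonglongrightarrow>
        1 / ((1 + cosh s) * (cosh (pi * s / pi) - cos (pi\<^sup>2 / pi)))" for s
      unfolding corner_integrand_def using cosh_plus_one_pos[of s]
      by (intro tendsto_intros lim') (auto simp: power2_eq_square add.commute)
    then show "AE s in lborel. (\<lambda>n. corner_integrand (X (n + n0)) s) \<longlonglongrightarrow> 1 / (1 + cosh s)\<^sup>2"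
      by (simp add: power2_eq_square add.commute)
    show "AE s in lborel. norm (corner_integrand (X (n + n0)) s) \<le> 1 / (1 + cosh s)" for n
      using X n0[of "n + n0"] by (auto intro!: corner_integrand_bound simp: less_imp_le)
  qed measurable
  then show "((\<lambda>\<alpha>. LBINT s. corner_integrand \<alpha> s) \<circ> X) \<longlonglongrightarrow> 2 / 3"
    unfolding integral_inverse_one_plus_cosh_squared o_def by (rule LIMSEQ_offset)
qed

lemma corner_term_asymptotics:
  "((\<lambda>\<alpha>. sin (pi\<^sup>2 / \<alpha>) * (LBINT s. corner_integrand \<alpha> s) / (pi - \<alpha>)) \<longlongrightarrow> - 2 / 3) (at_left pi)"
proof -
  have "((\<lambda>\<alpha>. sin (pi\<^sup>2 / \<alpha>)) has_real_derivative 1) (at pi)"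
    by (auto intro!: derivative_eq_intros simp: power2_eq_square)
  then have "((\<lambda>\<alpha>. (sin (pi\<^sup>2 / \<alpha>) - sin (pi\<^sup>2 / pi)) / (\<alpha> - pi)) \<longlongrightarrow> 1) (at pi)"
    by (simp add: has_field_derivative_iff)
  then have "((\<lambda>\<alpha>. sin (pi\<^sup>2 / \<alpha>) / (\<alpha> - pi)) \<longlongrightarrow> 1) (at_left pi)"
    by (simp add: power2_eq_square filterlim_at_split)
  then have "((\<lambda>\<alpha>. - (sin (pi\<^sup>2 / \<alpha>) / (\<alpha> - pi) * (LBINT s. corner_integrand \<alpha> s))) \<longlongrightarrow> - (1 * (2 / 3))) (at_left pi)"
    by (intro tendsto_intros tendsto_corner_integral)
  moreover have "- (x / (\<alpha> - pi) * y) = x * y / (pi - \<alpha>)" for x y \<alpha> :: real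
    by (metis minus_diff_eq minus_divide_right times_divide_eq_left)
  ultimately show ?thesis by simp
qed

text \<open>Stated with an error proportional to the exterior angle \<open>pi - \<alpha>\<close>, so that the errors can be summed
  over a polygon with an unbounded number of corners. At \<open>\<alpha> = pi\<close> both sides vanish.\<close>

lemma corner_term_estimate:
  assumes "\<epsilon> > 0"
  obtains \<eta> where "\<eta> > 0" "\<And>\<alpha>. \<lbrakk>pi - \<eta> < \<alpha>; \<alpha> \<le> pi\<rbrakk> \<Longrightarrow>
    \<bar>sin (pi\<^sup>2 / \<alpha>) * (LBINT s. corner_integrand \<alpha> s) + 2 / 3 * (pi - \<alpha>)\<bar> \<le> \<epsilon> * (pi - \<alpha>)"
proof -
  let ?G = "\<lambda>\<alpha>. sin (pi\<^sup>2 / \<alpha>) * (LBINT s. corner_integrand \<alpha> s)"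
  have "\<forall>\<^sub>F \<alpha> in at_left pi. dist (?G \<alpha> / (pi - \<alpha>)) (- 2 / 3) < \<epsilon>"
    using corner_term_asymptotics assms by (rule tendstoD)
  then obtain c where c: "c < pi" "\<And>\<alpha>. \<lbrakk>c < \<alpha>; \<alpha> < pi\<rbrakk> \<Longrightarrow> \<bar>?G \<alpha> / (pi - \<alpha>) + 2 / 3\<bar> < \<epsilon>"
    unfolding eventually_at_left_field by (auto simp: dist_real_def)
  show ?thesis
  proof (rule that[of "pi - c"])
    fix \<alpha> assume \<alpha>: "pi - (pi - c) < \<alpha>" "\<alpha> \<le> pi"
    show "\<bar>?G \<alpha> + 2 / 3 * (pi - \<alpha>)\<bar> \<le> \<epsilon> * (pi - \<alpha>)"
    proof (cases "\<alpha> = pi")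
      case False
      then have pos: "pi - \<alpha> > 0" using \<alpha> by simp
      have "?G \<alpha> + 2 / 3 * (pi - \<alpha>) = (?G \<alpha> / (pi - \<alpha>) + 2 / 3) * (pi - \<alpha>)"
        using pos by (simp add: distrib_right)
      also have "\<bar>\<dots>\<bar> = \<bar>?G \<alpha> / (pi - \<alpha>) + 2 / 3\<bar> * (pi - \<alpha>)"
        using pos by (simp add: abs_mult)
      also have "\<dots> \<le> \<epsilon> * (pi - \<alpha>)"
        using c(2)[of \<alpha>] \<alpha> pos by (intro mult_right_mono) auto
      finally show ?thesis .
    qed (simp add: power2_eq_square)
  qed (use c in simp)
qed

section \<open>The limit of the corner sums\<close>

theorem mainTheorem1:
  fixes \<Omega>s :: "nat \<Rightarrow> (real^2) set"
    and N :: "nat \<Rightarrow> nat"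
    and \<theta> :: "nat \<Rightarrow> nat \<Rightarrow> real"
    and \<Omega> :: "(real^2) set"
  assumes "\<And>k. convex_polygonal_domain (\<Omega>s k)"
    and "\<And>k. has_sides_and_interior_angles (\<Omega>s k) (N k) (\<theta> k)"
    and "planar_domain \<Omega>" and "\<Omega> \<noteq> {}" and "bounded \<Omega>" and "convex \<Omega>"
    and "smooth_boundary \<Omega>"
    and "hausdorff_converges (\<lambda>k. closure (\<Omega>s k)) (closure \<Omega>)"
  shows "(\<forall>\<^sub>F k in sequentially. \<forall>j\<in>{1..N k}. integrable lborel (corner_integrand (\<theta> k j))) \<and>
    (\<lambda>k. - (1 / (8 * pi)) *
        (\<Sum>j=1..N k. sin (pi\<^sup>2 / \<theta> k j) *
           (LBINT s. corner_integrand (\<theta> k j) s))) \<longlonglongrightarrow> 1 / 6"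
proof
  have "\<forall>\<^sub>F k in sequentially. \<forall>j\<in>{1..N k}. pi - pi / 3 < \<theta> k j \<and> \<theta> k j \<le> pi"
    using assms by (intro interior_angles_tend_to_pi[of \<Omega>s N \<theta> \<Omega>]) (auto simp: planar_domain_def)
  then show "\<forall>\<^sub>F k in sequentially. \<forall>j\<in>{1..N k}. integrable lborel (corner_integrand (\<theta> k j))"
    by eventually_elim (auto intro!: integrable_corner_integrand)
  define G where "G \<alpha> = sin (pi\<^sup>2 / \<alpha>) * (LBINT s. corner_integrand \<alpha> s)" for \<alpha>
  have "(\<lambda>k. \<Sum>j=1..N k. G (\<theta> k j)) \<longlonglongrightarrow> - (4 * pi / 3)"
  proof (rule tendstoI)
    fix e :: real assume "e > 0"
    then have "e / (4 * pi) > 0" by simp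
    then obtain \<eta> where \<eta>: "\<eta> > 0" "\<And>\<alpha>. \<lbrakk>pi - \<eta> < \<alpha>; \<alpha> \<le> pi\<rbrakk> \<Longrightarrow>
        \<bar>G \<alpha> + 2 / 3 * (pi - \<alpha>)\<bar> \<le> e / (4 * pi) * (pi - \<alpha>)"
      using corner_term_estimate[of "e / (4 * pi)"] unfolding G_def by blast
    have "\<forall>\<^sub>F k in sequentially. \<forall>j\<in>{1..N k}. pi - \<eta> < \<theta> k j \<and> \<theta> k j \<le> pi"
      using assms \<eta>(1) by (intro interior_angles_tend_to_pi[of \<Omega>s N \<theta> \<Omega>]) (auto simp: planar_domain_def)
    then show "\<forall>\<^sub>F k in sequentially. dist (\<Sum>j=1..N k. G (\<theta> k j)) (- (4 * pi / 3)) < e"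
    proof eventually_elim
      case (elim k)
      have total: "(\<Sum>j=1..N k. pi - \<theta> k j) = 2 * pi"
        using sum_exterior_angles assms(1,2) by blast
      have "(\<Sum>j=1..N k. G (\<theta> k j)) + 4 * pi / 3
          = (\<Sum>j=1..N k. G (\<theta> k j)) + 2 / 3 * (\<Sum>j=1..N k. pi - \<theta> k j)"
        by (simp only: total)
      also have "\<dots> = (\<Sum>j=1..N k. G (\<theta> k j) + 2 / 3 * (pi - \<theta> k j))"
        by (simp only: sum.distrib sum_distrib_left)
      also have "\<bar>\<dots>\<bar> \<le> (\<Sum>j=1..N k. e / (4 * pi) * (pi - \<theta> k j))"
        using elim \<eta>(2) by (intro order_trans[OF sum_abs] sum_mono) auto
      also have "\<dots> = e / (4 * pi) * (2 * pi)"
        by (simp only: sum_distrib_left[symmetric] total)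
      also have "\<dots> < e" using \<open>e > 0\<close> by simp
      finally show ?case by (simp add: dist_real_def)
    qed
  qed
  then have "(\<lambda>k. - (1 / (8 * pi)) * (\<Sum>j=1..N k. G (\<theta> k j))) \<longlonglongrightarrow> - (1 / (8 * pi)) * - (4 * pi / 3)"
    by (intro tendsto_intros)
  then show "(\<lambda>k. - (1 / (8 * pi)) * (\<Sum>j=1..N k. sin (pi\<^sup>2 / \<theta> k j) *
      (LBINT s. corner_integrand (\<theta> k j) s))) \<longlonglongrightarrow> 1 / 6"
    by (simp add: G_def)
qed

end
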